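(* Let $(X,\sim)$ be a set with an equivalence relation having more than two equivalence classes, let $U\le \mathrm{Sym}(X,\sim)$ be a subgroup and $\tau\in\mathrm{Sym}(X,\sim)$, such that: (C1) $U$ fixes a point $\infty\in X$ and acts sharply transitively on $X\setminus\overline{\infty}$; (C1') the action induced by $U$ on $\overline{X}$ is sharply transitive on $\overline{X}\setminus\{\overline{\infty}\}$; (C2) $\infty\tau\nsim\infty$ and $\infty\tau^2=\infty$. Let $\mathbb{M}(U,\tau)$ be the family $(U_x)_{x\in X}$ of subgroups of $\mathrm{Sym}(X,\sim)$ constructed from these data as in the context. Then $\mathbb{M}(U,\tau)$ is a local Moufang set if and only if the Hua map $h_x$ normalizes $U$ (that is, $U^{h_x}=U$) for all units $x\in X$.
   Context: Conventions: all actions are on the right, $xg$ (or $x\cdot g$) is the image of $x$ under $g$, products are composed left to right, $g^h=h^{-1}gh$, and $V^h=h^{-1}Vh$ for a subgroup $V$. For a set with an equivalence relation $(X,\sim)$, $\overline{x}$ is the class of $x$, $\overline{X}$ is the set of classes, and $\mathrm{Sym}(X,\sim)$ is the group of permutations of $X$ preserving the equivalence relation; $g\in\mathrm{Sym}(X,\sim)$ induces $\overline{g}\in\mathrm{Sym}(\overline{X})$. A local Moufang set consists of $(X,\sim)$ with $|\overline{X}|>2$ and subgroups $U_x\le\mathrm{Sym}(X,\sim)$ for $x\in X$ (root groups). Write $U_{\overline{x}}$ for the image of $U_x$ in $\mathrm{Sym}(\overline{X})$ and $G=\langle U_x\mid x\in X\rangle$. The axioms are: (LM1) if $x\sim y$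 then $U_{\overline{x}}=U_{\overline{y}}$; (LM2) for $x\in X$, $U_x$ fixes $x$ and acts sharply transitively on $X\setminus\overline{x}$; (LM2') for $\overline{x}\in\overline{X}$, $U_{\overline{x}}$ fixes $\overline{x}$ and acts sharply transitively on $\overline{X}\setminus\{\overline{x}\}$; (LM3) $U_x^g=U_{xg}$ for all $x\in X$, $g\in G$. Construction $\mathbb{M}(U,\tau)$: put $0:=\infty\tau$. For $x\nsim\infty$ let $\alpha_x$ be the unique element of $U$ mapping $0$ to $x$, let $-x:=0\alpha_x^{-1}$, and let $\gamma_x:=\alpha_x^\tau=\tau^{-1}\alpha_x\tau$ (which maps $\infty$ to $x\tau$). Put $U_\infty:=U$, $U_0:=U_\infty^\tau$, $U_x:=U_0^{\alpha_x}$ for $x\nsim\infty$, and $U_x:=U_\infty^{\gamma_{x\tau^{-1}}}$ for $x\sim\infty$. A unit is an $x\in X$ with $x\nsim 0$ and $x\nsim\infty$. For a unit $x$ the Hua map is $h_x:=\tau\,\alpha_x\,\tau^{-1}\,\alpha_{-(x\tau^{-1})}\,\tau\,\alpha_{-((-(x\tau^{-1}))\tau)}$. *)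

theory Defs
  imports "HOL-Algebra.Generated_Groups" "HOL-Combinatorics.Permutations"
begin

text \<open>
  A set with an equivalence relation is given by \<open>X\<close> and \<open>R\<close> with \<^term>\<open>equiv X R\<close>; then
  \<open>x \<sim> y\<close> is \<open>(x, y) \<in> R\<close>, the class of \<open>x\<close> is \<open>R `` {x}\<close> and the set of classes is \<open>X // R\<close>.
  A permutation of \<open>X\<close> is a function that permutes \<open>X\<close>, so it is the identity outside \<open>X\<close>, and
  two permutations are equal as soon as they agree on \<open>X\<close>.

  Actions are on the right: \<open>x g\<close> is written \<open>g x\<close>, and the group multiplication composes from
  left to right, so that \<open>(g \<otimes> h) x = h (g x)\<close>.
\<close>

definition sym_rel :: "'a set \<Rightarrow> ('a \<times> 'a) set \<Rightarrow> ('a \<Rightarrow> 'a) monoid" where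
  "sym_rel X R =
     \<lparr>carrier = {g. g permutes X \<and> (\<forall>x\<in>X. \<forall>y\<in>X. (g x, g y) \<in> R \<longleftrightarrow> (x, y) \<in> R)},
      monoid.mult = (\<lambda>g h. h \<circ> g),
      monoid.one = id\<rparr>"

lemma group_sym_rel: "group (sym_rel X R)"
proof (rule groupI)
  fix g h assume g: "g \<in> carrier (sym_rel X R)" and h: "h \<in> carrier (sym_rel X R)"
  then have "g permutes X" "h permutes X" by (simp_all add: sym_rel_def)
  with g h show "g \<otimes>\<^bsub>sym_rel X R\<^esub> h \<in> carrier (sym_rel X R)"
    using permutes_in_image[OF \<open>g permutes X\<close>] by (simp add: sym_rel_def permutes_compose)
next
  show "\<one>\<^bsub>sym_rel X R\<^esub> \<in> carrier (sym_rel X R)"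
    by (simp add: sym_rel_def permutes_id)
next
  fix g assume g: "g \<in> carrier (sym_rel X R)"
  then have p: "g permutes X"
    and r: "\<And>x y. x \<in> X \<Longrightarrow> y \<in> X \<Longrightarrow> (g x, g y) \<in> R \<longleftrightarrow> (x, y) \<in> R"
    by (simp_all add: sym_rel_def)
  let ?k = "Hilbert_Choice.inv g"
  have k: "?k permutes X" by (rule permutes_inv[OF p])
  have "(?k x, ?k y) \<in> R \<longleftrightarrow> (x, y) \<in> R" if "x \<in> X" "y \<in> X" for x y
    using r[of "?k x" "?k y"] that by (simp add: permutes_in_image[OF k] permutes_inverses(1)[OF p])
  with k have "?k \<in> carrier (sym_rel X R)" by (simp add: sym_rel_def)
  moreover have "?k \<otimes>\<^bsub>sym_rel X R\<^esub> g = \<one>\<^bsub>sym_rel X R\<^esub>"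
    using permutes_inv_o(1)[OF p] by (simp add: sym_rel_def)
  ultimately show "\<exists>h\<in>carrier (sym_rel X R). h \<otimes>\<^bsub>sym_rel X R\<^esub> g = \<one>\<^bsub>sym_rel X R\<^esub>"
    by blast
qed (simp_all add: sym_rel_def comp_assoc)

text \<open>
  The permutation of \<open>X // R\<close> induced by \<open>g\<close>, again extended by the identity. The image of a
  subgroup \<open>V\<close> in the symmetric group on \<open>X // R\<close> is therefore \<open>induced X R ` V\<close>.
\<close>

definition induced :: "'a set \<Rightarrow> ('a \<times> 'a) set \<Rightarrow> ('a \<Rightarrow> 'a) \<Rightarrow> 'a set \<Rightarrow> 'a set" where
  "induced X R g = (\<lambda>C. if C \<in> X // R then g ` C else C)"

definition sharply_transitive_on :: "('b \<Rightarrow> 'b) set \<Rightarrow> 'b set \<Rightarrow> bool" where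
  "sharply_transitive_on H Y \<longleftrightarrow>
     (\<forall>h\<in>H. h ` Y = Y) \<and> (\<forall>y\<in>Y. \<forall>z\<in>Y. \<exists>!h. h \<in> H \<and> h y = z)"

definition conj_set :: "('g, 'm) monoid_scheme \<Rightarrow> 'g set \<Rightarrow> 'g \<Rightarrow> 'g set" where
  "conj_set G V h = (\<lambda>v. inv\<^bsub>G\<^esub> h \<otimes>\<^bsub>G\<^esub> v \<otimes>\<^bsub>G\<^esub> h) ` V"

definition more_than_two_classes :: "'a set \<Rightarrow> ('a \<times> 'a) set \<Rightarrow> bool" where
  "more_than_two_classes X R \<longleftrightarrow> infinite (X // R) \<or> card (X // R) > 2"

text \<open>
  Only the values \<open>U x\<close> with \<open>x \<in> X\<close> are relevant. In \<open>LM2'\<close> the class is given by a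
  representative; \<open>LM1\<close> says that this choice does not matter.
\<close>

locale local_moufang_set =
  fixes X :: "'a set" and R :: "('a \<times> 'a) set" and U :: "'a \<Rightarrow> ('a \<Rightarrow> 'a) set"
  assumes equiv: "equiv X R"
    and classes: "more_than_two_classes X R"
    and root_subgroup: "\<forall>x\<in>X. subgroup (U x) (sym_rel X R)"
    and LM1: "\<forall>x\<in>X. \<forall>y\<in>X. (x, y) \<in> R \<longrightarrow> induced X R ` U x = induced X R ` U y"
    and LM2: "\<forall>x\<in>X. (\<forall>u\<in>U x. u x = x) \<and> sharply_transitive_on (U x) (X - R `` {x})"
    and LM2': "\<forall>x\<in>X. (\<forall>u\<in>induced X R ` U x. u (R `` {x}) = R `` {x}) \<and>
                 sharply_transitive_on (induced X R ` U x) (X // R - {R `` {x}})"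
    and LM3: "\<forall>x\<in>X. \<forall>g\<in>generate (sym_rel X R) (\<Union>y\<in>X. U y).
                 conj_set (sym_rel X R) (U x) g = U (g x)"

text \<open>
  The construction \<open>\<M>(U, \<tau>)\<close>. The parameter \<open>p\<close> is the point \<open>\<infinity>\<close>, so that \<open>0 = \<infinity>\<tau>\<close> is \<open>\<tau> p\<close>.
\<close>

definition alpha :: "('a \<Rightarrow> 'a) set \<Rightarrow> ('a \<Rightarrow> 'a) \<Rightarrow> 'a \<Rightarrow> 'a \<Rightarrow> 'a \<Rightarrow> 'a" where
  "alpha U \<tau> p x = (THE a. a \<in> U \<and> a (\<tau> p) = x)"

definition neg ::
  "'a set \<Rightarrow> ('a \<times> 'a) set \<Rightarrow> ('a \<Rightarrow> 'a) set \<Rightarrow> ('a \<Rightarrow> 'a) \<Rightarrow> 'a \<Rightarrow> 'a \<Rightarrow> 'a" where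
  "neg X R U \<tau> p x = (inv\<^bsub>sym_rel X R\<^esub> (alpha U \<tau> p x)) (\<tau> p)"

definition gamma ::
  "'a set \<Rightarrow> ('a \<times> 'a) set \<Rightarrow> ('a \<Rightarrow> 'a) set \<Rightarrow> ('a \<Rightarrow> 'a) \<Rightarrow> 'a \<Rightarrow> 'a \<Rightarrow> 'a \<Rightarrow> 'a" where
  "gamma X R U \<tau> p x =
     inv\<^bsub>sym_rel X R\<^esub> \<tau> \<otimes>\<^bsub>sym_rel X R\<^esub> alpha U \<tau> p x \<otimes>\<^bsub>sym_rel X R\<^esub> \<tau>"

text \<open>
  The two cases include \<open>U\<^sub>0 = U\<^sup>\<tau>\<close> and \<open>U\<^sub>\<infinity> = U\<close>: the element \<open>\<alpha>\<^sub>0\<close> is the identity, and, as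
  \<open>\<infinity>\<tau>\<^sup>2 = \<infinity>\<close> gives \<open>\<infinity>\<tau>\<^sup>-\<^sup>1 = 0\<close>, so is the element \<open>\<gamma>\<close> used at \<open>x = \<infinity>\<close>.
\<close>

definition root_group ::
  "'a set \<Rightarrow> ('a \<times> 'a) set \<Rightarrow> ('a \<Rightarrow> 'a) set \<Rightarrow> ('a \<Rightarrow> 'a) \<Rightarrow> 'a \<Rightarrow> 'a \<Rightarrow> ('a \<Rightarrow> 'a) set" where
  "root_group X R U \<tau> p x =
     (if (x, p) \<notin> R
      then conj_set (sym_rel X R) (conj_set (sym_rel X R) U \<tau>) (alpha U \<tau> p x)
      else conj_set (sym_rel X R) U (gamma X R U \<tau> p ((inv\<^bsub>sym_rel X R\<^esub> \<tau>) x)))"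

definition is_unit_point ::
  "'a set \<Rightarrow> ('a \<times> 'a) set \<Rightarrow> ('a \<Rightarrow> 'a) \<Rightarrow> 'a \<Rightarrow> 'a \<Rightarrow> bool" where
  "is_unit_point X R \<tau> p x \<longleftrightarrow> x \<in> X \<and> (x, \<tau> p) \<notin> R \<and> (x, p) \<notin> R"

definition hua ::
  "'a set \<Rightarrow> ('a \<times> 'a) set \<Rightarrow> ('a \<Rightarrow> 'a) set \<Rightarrow> ('a \<Rightarrow> 'a) \<Rightarrow> 'a \<Rightarrow> 'a \<Rightarrow> 'a \<Rightarrow> 'a" where
  "hua X R U \<tau> p x =
     (let S = sym_rel X R;
          y = neg X R U \<tau> p ((inv\<^bsub>S\<^esub> \<tau>) x)
      in \<tau> \<otimes>\<^bsub>S\<^esub> alpha U \<tau> p x \<otimes>\<^bsub>S\<^esub> inv\<^bsub>S\<^esub> \<tau> \<otimes>\<^bsub>S\<^esub> alpha U \<tau> p y \<otimes>\<^bsub>S\<^esub> \<tau>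
           \<otimes>\<^bsub>S\<^esub> alpha U \<tau> p (neg X R U \<tau> p (\<tau> y)))"

end

theory Submission
  imports Defs
begin

text \<open>
  For a unit \<open>x\<close> one has \<open>h\<^sub>x = \<tau> \<mu>\<^sub>x\<close> with \<open>\<mu>\<^sub>x \<in> U\<^sub>\<infinity> U\<^sub>0 U\<^sub>\<infinity>\<close> interchanging \<open>0\<close> and \<open>\<infinity>\<close>, so \<open>h\<^sub>x\<close>
  normalizes \<open>U\<close> exactly when \<open>U\<^sub>0\<close> is conjugated to \<open>U\<^sub>\<infinity>\<close> by \<open>\<mu>\<^sub>x\<close>; this is an instance of LM3.

  Conversely, \<open>\<mu>\<^sub>x\<^sup>-\<^sup>1\<close> is again of the form \<open>\<mu>\<^sub>y\<close>, hence \<open>\<mu>\<^sub>x\<close> interchanges \<open>U\<^sub>\<infinity>\<close> and \<open>U\<^sub>0\<close>, and the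
  hypothesis makes the two descriptions \<open>U\<^sub>0\<^sup>\<alpha>\<close> and \<open>U\<^sub>\<infinity>\<^sup>\<gamma>\<close> of a root group at a unit agree.
  Therefore \<open>\<mu>\<^sub>x\<close> permutes the root groups in the same way as the points. An element of \<open>U\<^sub>\<infinity>\<close> clearly
  does so for the points outside the class of \<open>\<infinity>\<close>; for a point in that class, one writes
  \<open>\<alpha>\<^sub>x = \<mu>\<^sub>x \<alpha> \<gamma>\<close>, where \<open>\<mu>\<^sub>x\<close> moves the point into the class of \<open>0\<close>, where \<open>\<alpha> \<in> U\<^sub>\<infinity>\<close> and then
  \<open>\<gamma> \<in> U\<^sub>0\<close> are known to behave well.
\<close>

section \<open>Conjugation in groups\<close>

context group
begin

lemma conj_set_mult:
  assumes "V \<subseteq> carrier G" "g \<in> carrier G" "h \<in> carrier G"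
  shows "conj_set G (conj_set G V g) h = conj_set G V (g \<otimes> h)"
proof -
  have "inv h \<otimes> (inv g \<otimes> v \<otimes> g) \<otimes> h = inv (g \<otimes> h) \<otimes> v \<otimes> (g \<otimes> h)" if "v \<in> V" for v
  proof -
    from that assms have "v \<in> carrier G" by auto
    with assms show ?thesis by (simp add: inv_mult_group m_assoc)
  qed
  then show ?thesis by (simp add: conj_set_def image_image cong: image_cong)
qed

lemma conj_set_one: "V \<subseteq> carrier G \<Longrightarrow> conj_set G V \<one> = V"
  by (force simp: conj_set_def image_iff)

lemma conj_set_closed: "V \<subseteq> carrier G \<Longrightarrow> g \<in> carrier G \<Longrightarrow> conj_set G V g \<subseteq> carrier G"
  by (auto simp: conj_set_def)

lemma conj_set_inv:
  assumes "V \<subseteq> carrier G" "g \<in> carrier G" "conj_set G V g = W"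
  shows "conj_set G W (inv g) = V"
  using assms conj_set_mult[of V g "inv g"] by (simp add: conj_set_one)

lemma conj_set_memI: "v \<in> V \<Longrightarrow> inv g \<otimes> v \<otimes> g \<in> conj_set G V g"
  by (auto simp: conj_set_def)

lemma subgroup_conj_set:
  assumes V: "subgroup V G" and g: "g \<in> carrier G"
  shows "subgroup (conj_set G V g) G"
proof (rule subgroupI)
  show "conj_set G V g \<subseteq> carrier G"
    by (rule conj_set_closed[OF subgroup.subset[OF V] g])
  show "conj_set G V g \<noteq> {}"
    using subgroup.one_closed[OF V] by (auto simp: conj_set_def)
next
  fix a assume "a \<in> conj_set G V g"
  then obtain v where v: "v \<in> V" "a = inv g \<otimes> v \<otimes> g" by (auto simp: conj_set_def)
  with V g have "inv a = inv g \<otimes> inv v \<otimes> g"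
    by (simp add: inv_mult_group m_assoc subgroup.mem_carrier)
  with V v show "inv a \<in> conj_set G V g"
    by (simp add: conj_set_memI subgroup.m_inv_closed)
next
  fix a b assume "a \<in> conj_set G V g" "b \<in> conj_set G V g"
  then obtain v w where v: "v \<in> V" "a = inv g \<otimes> v \<otimes> g" and w: "w \<in> V" "b = inv g \<otimes> w \<otimes> g"
    by (auto simp: conj_set_def)
  then have vw: "v \<in> carrier G" "w \<in> carrier G" using V by (simp_all add: subgroup.mem_carrier)
  \<comment> \<open>Right association hides the inner pair \<open>g\<close>, \<open>inv g\<close>,
    so its cancellation is supplied in exactly the shape in which it occurs below.\<close>
  have "g \<otimes> (inv g \<otimes> (w \<otimes> g)) = w \<otimes> g"
    using vw g by (simp add: m_assoc[symmetric])
  then have "a \<otimes> b = inv g \<otimes> (v \<otimes> w) \<otimes> g"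
    using v w vw g by (simp add: m_assoc)
  with V v w show "a \<otimes> b \<in> conj_set G V g"
    by (simp add: conj_set_memI subgroup.m_closed)
qed

lemma conj_set_self:
  assumes V: "subgroup V G" and g: "g \<in> V"
  shows "conj_set G V g = V"
proof -
  have sub: "conj_set G V h \<subseteq> V" if "h \<in> V" for h
    using that V by (auto simp: conj_set_def intro!: subgroup.m_closed subgroup.m_inv_closed)
  have "v \<in> conj_set G V g" if v: "v \<in> V" for v
  proof -
    have c: "v \<in> carrier G" "g \<in> carrier G" using V v g by (simp_all add: subgroup.mem_carrier)
    have w: "g \<otimes> v \<otimes> inv g \<in> V"
      using V v g by (simp add: subgroup.m_closed subgroup.m_inv_closed)
    have "inv g \<otimes> (g \<otimes> v \<otimes> inv g) \<otimes> g = v"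
      using c by (simp add: m_assoc) (simp add: m_assoc[symmetric])
    with conj_set_memI[OF w, of g] show ?thesis by simp
  qed
  with sub[OF g] show ?thesis by blast
qed

end

text \<open>Stated for an arbitrary bijection with inverse \<open>f'\<close>, so that it serves both
  for permutations of \<open>X\<close> (LM2) and for induced permutations of the classes
  (LM2').\<close>

lemma sharply_transitive_on_conj:
  assumes st: "sharply_transitive_on H Y"
    and ff': "\<And>x. f (f' x) = x" and f'f: "\<And>x. f' (f x) = x"
  shows "sharply_transitive_on ((\<lambda>h. f \<circ> h \<circ> f') ` H) (f ` Y)"
  unfolding sharply_transitive_on_def
proof (intro conjI ballI)
  fix k assume "k \<in> (\<lambda>h. f \<circ> h \<circ> f') ` H"
  then obtain h where h: "h \<in> H" "k = f \<circ> h \<circ> f'" by auto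
  with st have "h ` Y = Y" by (simp add: sharply_transitive_on_def)
  have "k ` f ` Y = f ` h ` Y" by (simp add: h(2) image_image f'f)
  with \<open>h ` Y = Y\<close> show "k ` f ` Y = f ` Y" by simp
next
  fix y' z' assume "y' \<in> f ` Y" "z' \<in> f ` Y"
  then obtain y z where yz: "y \<in> Y" "y' = f y" "z \<in> Y" "z' = f z" by auto
  with st have ex1: "\<exists>!h. h \<in> H \<and> h y = z" by (simp add: sharply_transitive_on_def)
  then obtain h where h: "h \<in> H" "h y = z" by auto
  have inj: "a = b" if "f a = f b" for a b using that f'f by metis
  show "\<exists>!k. k \<in> (\<lambda>h. f \<circ> h \<circ> f') ` H \<and> k y' = z'"
  proof (rule ex1I[of _ "f \<circ> h \<circ> f'"])
    show "f \<circ> h \<circ> f' \<in> (\<lambda>h. f \<circ> h \<circ> f') ` H \<and> (f \<circ> h \<circ> f') y' = z'"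
      using h yz by (simp add: f'f)
  next
    fix k assume "k \<in> (\<lambda>h. f \<circ> h \<circ> f') ` H \<and> k y' = z'"
    then obtain h2 where h2: "h2 \<in> H" "k = f \<circ> h2 \<circ> f'" "k y' = z'" by auto
    with yz have "h2 y = z" by (auto simp: f'f intro: inj)
    with ex1 h h2 show "k = f \<circ> h \<circ> f'" by blast
  qed
qed

section \<open>Permutations preserving an equivalence relation\<close>

locale equiv_on =
  fixes X :: "'a set" and R :: "('a \<times> 'a) set"
  assumes equiv: "equiv X R"
begin

sublocale S: group "sym_rel X R"
  by (rule group_sym_rel)

abbreviation S :: "('a \<Rightarrow> 'a) monoid" where "S \<equiv> sym_rel X R"

lemma mult_apply: "(g \<otimes>\<^bsub>S\<^esub> h) x = h (g x)"
  by (simp add: sym_rel_def)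

lemma one_apply: "\<one>\<^bsub>S\<^esub> x = x"
  by (simp add: sym_rel_def)

lemma apply_in: "g \<in> carrier S \<Longrightarrow> g x \<in> X \<longleftrightarrow> x \<in> X"
  by (simp add: sym_rel_def permutes_in_image)

lemma apply_rel: "g \<in> carrier S \<Longrightarrow> x \<in> X \<Longrightarrow> y \<in> X \<Longrightarrow> (g x, g y) \<in> R \<longleftrightarrow> (x, y) \<in> R"
  by (simp add: sym_rel_def)

lemma inv_apply: "g \<in> carrier S \<Longrightarrow> (inv\<^bsub>S\<^esub> g) (g x) = x"
  using mult_apply[of g "inv\<^bsub>S\<^esub> g" x] by (simp add: one_apply)

lemma apply_inv: "g \<in> carrier S \<Longrightarrow> g ((inv\<^bsub>S\<^esub> g) x) = x"
  using mult_apply[of "inv\<^bsub>S\<^esub> g" g x] by (simp add: one_apply)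

lemma rel_refl: "x \<in> X \<Longrightarrow> (x, x) \<in> R"
  using equiv by (simp add: equiv_def refl_on_def)

lemma rel_sym: "(x, y) \<in> R \<Longrightarrow> (y, x) \<in> R"
  using equiv by (meson equiv_def symE)

lemma rel_trans: "(x, y) \<in> R \<Longrightarrow> (y, z) \<in> R \<Longrightarrow> (x, z) \<in> R"
  using equiv by (meson equiv_def transE)

lemma rel_in: "(x, y) \<in> R \<Longrightarrow> x \<in> X \<and> y \<in> X"
  using equiv_type[OF equiv] by auto

lemma image_class:
  assumes g: "g \<in> carrier S" and x: "x \<in> X"
  shows "g ` (R `` {x}) = R `` {g x}"
proof (intro equalityI subsetI)
  fix w assume "w \<in> g ` (R `` {x})"
  then show "w \<in> R `` {g x}" using apply_rel[OF g] rel_in by force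
next
  fix w assume "w \<in> R `` {g x}"
  then have w: "(g x, w) \<in> R" by simp
  let ?v = "(inv\<^bsub>S\<^esub> g) w"
  have gv: "g ?v = w" by (rule apply_inv[OF g])
  then have "?v \<in> X" using w rel_in apply_in[OF g, of ?v] by simp
  with w gv x have "(x, ?v) \<in> R" using apply_rel[OF g, of x ?v] by simp
  with gv show "w \<in> g ` (R `` {x})" by (metis ImageI image_eqI singletonI)
qed

lemma induced_class: "g \<in> carrier S \<Longrightarrow> x \<in> X \<Longrightarrow> induced X R g (R `` {x}) = R `` {g x}"
  by (simp add: induced_def image_class quotientI)

text \<open>The second assumption accounts for sets that are not classes, where
  \<open>induced\<close> is the identity by convention.\<close>

lemma induced_eqI:
  assumes "\<And>x. x \<in> X \<Longrightarrow> induced X R g (R `` {x}) = f (R `` {x})"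
    and "\<And>C. C \<notin> X // R \<Longrightarrow> f C = C"
  shows "induced X R g = f"
proof
  fix C show "induced X R g C = f C"
  proof (cases "C \<in> X // R")
    case True
    then show ?thesis using assms(1) by (elim quotientE) simp
  next
    case False
    with assms(2) show ?thesis by (simp add: induced_def)
  qed
qed

lemma induced_mult:
  assumes "g \<in> carrier S" "h \<in> carrier S"
  shows "induced X R (g \<otimes>\<^bsub>S\<^esub> h) = induced X R h \<circ> induced X R g"
  using assms
  by (intro induced_eqI) (simp_all add: induced_class mult_apply apply_in, simp add: induced_def)

lemma induced_one: "induced X R \<one>\<^bsub>S\<^esub> = id"
  by (rule induced_eqI) (simp_all add: induced_class one_apply)

lemma induced_inv:
  assumes "g \<in> carrier S"
  shows "induced X R (inv\<^bsub>S\<^esub> g) (induced X R g C) = C"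
    and "induced X R g (induced X R (inv\<^bsub>S\<^esub> g) C) = C"
  using assms induced_mult[of g "inv\<^bsub>S\<^esub> g"] induced_mult[of "inv\<^bsub>S\<^esub> g" g]
  by (simp_all add: induced_one fun_eq_iff)

lemma conj_set_eq:
  "conj_set S V g = (\<lambda>v. g \<circ> v \<circ> inv\<^bsub>S\<^esub> g) ` V"
  by (simp add: conj_set_def fun_eq_iff mult_apply sym_rel_def comp_assoc)

lemma induced_conj_set:
  assumes "V \<subseteq> carrier S" "g \<in> carrier S"
  shows "induced X R ` conj_set S V g =
    (\<lambda>v. induced X R g \<circ> v \<circ> induced X R (inv\<^bsub>S\<^esub> g)) ` induced X R ` V"
proof -
  have "induced X R (inv\<^bsub>S\<^esub> g \<otimes>\<^bsub>S\<^esub> v \<otimes>\<^bsub>S\<^esub> g) =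
      induced X R g \<circ> induced X R v \<circ> induced X R (inv\<^bsub>S\<^esub> g)" if "v \<in> V" for v
  proof -
    from that assms have "v \<in> carrier S" by auto
    with assms show ?thesis by (simp add: induced_mult comp_assoc)
  qed
  then show ?thesis by (simp add: conj_set_def image_image cong: image_cong)
qed

text \<open>The source of LM1: root groups are conjugates of \<open>U\<close>, and equivalent points
  will have conjugating elements with the same induced permutation.\<close>

lemma induced_conj_set_cong:
  assumes V: "V \<subseteq> carrier S" and gh: "g \<in> carrier S" "h \<in> carrier S"
    and eq: "induced X R g = induced X R h"
  shows "induced X R ` conj_set S V g = induced X R ` conj_set S V h"
proof -
  have "induced X R (inv\<^bsub>S\<^esub> g) = induced X R (inv\<^bsub>S\<^esub> h)"
    using induced_inv[OF gh(1)] induced_inv[OF gh(2)] eq by (metis ext)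
  with V gh eq show ?thesis by (simp add: induced_conj_set)
qed

lemma image_outside_class:
  assumes g: "g \<in> carrier S" and x: "x \<in> X"
  shows "g ` (X - R `` {x}) = X - R `` {g x}"
proof -
  have inj: "inj g" using inv_apply[OF g] by (metis injI)
  have "g ` X = X" using g by (simp add: sym_rel_def permutes_image)
  with inj image_class[OF g x] show ?thesis by (simp add: image_set_diff)
qed

lemma induced_image_other_classes:
  assumes g: "g \<in> carrier S" and x: "x \<in> X"
  shows "induced X R g ` (X // R - {R `` {x}}) = X // R - {R `` {g x}}"
proof -
  have inj: "inj (induced X R g)" using induced_inv(1)[OF g] by (metis injI)
  have sub: "induced X R h ` (X // R) \<subseteq> X // R" if "h \<in> carrier S" for h
    using that by (auto elim!: quotientE simp: induced_class apply_in quotientI)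
  have "X // R \<subseteq> induced X R g ` (X // R)"
    using sub[of "inv\<^bsub>S\<^esub> g"] g induced_inv(2)[OF g]
    by (metis S.inv_closed image_subset_iff rev_image_eqI subsetI)
  with sub[OF g] have "induced X R g ` (X // R) = X // R" by blast
  with inj show ?thesis by (simp add: image_set_diff induced_class[OF g x])
qed

end

section \<open>The construction\<close>

locale moufang_construction = equiv_on X R
  for X :: "'a set" and R :: "('a \<times> 'a) set" +
  fixes U :: "('a \<Rightarrow> 'a) set" and \<tau> :: "'a \<Rightarrow> 'a" and p :: 'a
  assumes classes: "more_than_two_classes X R"
    and U_subgroup: "subgroup U (sym_rel X R)"
    and tau: "\<tau> \<in> carrier (sym_rel X R)"
    and p: "p \<in> X"
    and U_fix: "u \<in> U \<Longrightarrow> u p = p"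
    and U_sharp: "sharply_transitive_on U (X - R `` {p})"
    and U_induced_sharp: "sharply_transitive_on (induced X R ` U) (X // R - {R `` {p}})"
    and tau_p: "(\<tau> p, p) \<notin> R"
    and tau_tau_p: "\<tau> (\<tau> p) = p"
begin

abbreviation conj :: "('a \<Rightarrow> 'a) set \<Rightarrow> ('a \<Rightarrow> 'a) \<Rightarrow> ('a \<Rightarrow> 'a) set" where
  "conj \<equiv> conj_set S"

abbreviation zero :: 'a where "zero \<equiv> \<tau> p"
abbreviation U0 :: "('a \<Rightarrow> 'a) set" where "U0 \<equiv> conj U \<tau>"
abbreviation \<alpha> :: "'a \<Rightarrow> 'a \<Rightarrow> 'a" where "\<alpha> \<equiv> alpha U \<tau> p"
abbreviation \<gamma> :: "'a \<Rightarrow> 'a \<Rightarrow> 'a" where "\<gamma> \<equiv> gamma X R U \<tau> p"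
abbreviation minus :: "'a \<Rightarrow> 'a" where "minus \<equiv> neg X R U \<tau> p"
abbreviation root :: "'a \<Rightarrow> ('a \<Rightarrow> 'a) set" where "root \<equiv> root_group X R U \<tau> p"
abbreviation itau :: "'a \<Rightarrow> 'a" where "itau \<equiv> inv\<^bsub>S\<^esub> \<tau>"
abbreviation is_unit :: "'a \<Rightarrow> bool" where "is_unit \<equiv> is_unit_point X R \<tau> p"

section \<open>Parametrization of \<open>U\<close> and \<open>U0\<close> by points\<close>

lemma U_carrier: "U \<subseteq> carrier S"
  by (rule subgroup.subset[OF U_subgroup])

lemma U_closed [simp]: "u \<in> U \<Longrightarrow> u \<in> carrier S"
  using U_carrier by auto

lemma U_inv [simp]: "u \<in> U \<Longrightarrow> inv\<^bsub>S\<^esub> u \<in> U"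
  by (rule subgroup.m_inv_closed[OF U_subgroup])

lemma U_mult [simp]: "u \<in> U \<Longrightarrow> v \<in> U \<Longrightarrow> u \<otimes>\<^bsub>S\<^esub> v \<in> U"
  by (rule subgroup.m_closed[OF U_subgroup])

lemma U0_subgroup: "subgroup U0 S"
  by (rule S.subgroup_conj_set[OF U_subgroup tau])

lemma U0_carrier: "U0 \<subseteq> carrier S"
  by (rule subgroup.subset[OF U0_subgroup])

lemma U0_closed [simp]: "u \<in> U0 \<Longrightarrow> u \<in> carrier S"
  using U0_carrier by auto

lemma zero_in: "zero \<in> X"
  using apply_in[OF tau] p by simp

lemma itau_p: "itau p = zero"
  using inv_apply[OF tau, of zero] by (simp add: tau_tau_p)

lemma itau_zero: "itau zero = p"
  by (rule inv_apply[OF tau])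

lemma U0_fix: "u \<in> U0 \<Longrightarrow> u zero = zero"
  by (auto simp: conj_set_def mult_apply itau_zero U_fix)

lemma alpha_props:
  assumes "x \<in> X" "(x, p) \<notin> R"
  shows "\<alpha> x \<in> U" "\<alpha> x zero = x"
proof -
  have "zero \<in> X - R `` {p}" "x \<in> X - R `` {p}"
    using assms zero_in tau_p rel_sym by auto
  then have "\<exists>!a. a \<in> U \<and> a zero = x"
    using U_sharp by (simp add: sharply_transitive_on_def)
  from theI'[OF this] show "\<alpha> x \<in> U" "\<alpha> x zero = x"
    by (simp_all add: alpha_def)
qed

lemma U_rel_p: "u \<in> U \<Longrightarrow> x \<in> X \<Longrightarrow> (u x, p) \<in> R \<longleftrightarrow> (x, p) \<in> R"
  using apply_rel[of u x p] p by (simp add: U_fix)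

lemma U0_rel_zero: "u \<in> U0 \<Longrightarrow> x \<in> X \<Longrightarrow> (u x, zero) \<in> R \<longleftrightarrow> (x, zero) \<in> R"
  using apply_rel[of u x zero] zero_in by (simp add: U0_fix)

text \<open>Converse to \<open>alpha_props\<close>: by sharp transitivity an element of
  \<open>U\<close> is recognized by its image of \<open>zero\<close>.\<close>

lemma alpha_apply_zero:
  assumes a: "a \<in> U"
  shows "\<alpha> (a zero) = a"
proof -
  have "(a zero, p) \<notin> R" using a zero_in tau_p by (simp add: U_rel_p)
  then have mem: "zero \<in> X - R `` {p}" "a zero \<in> X - R `` {p}"
    using a zero_in tau_p rel_sym by (auto simp: apply_in)
  then have "\<exists>!b. b \<in> U \<and> b zero = a zero"
    using U_sharp by (simp add: sharply_transitive_on_def)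
  with a show ?thesis
    unfolding alpha_def by (intro the1_equality) auto
qed

lemma minus_props:
  assumes "x \<in> X" "(x, p) \<notin> R"
  shows "\<alpha> (minus x) = inv\<^bsub>S\<^esub> (\<alpha> x)" "minus (minus x) = x"
    "minus x \<in> X" "(minus x, p) \<notin> R"
proof -
  note a = alpha_props[OF assms]
  show 1: "\<alpha> (minus x) = inv\<^bsub>S\<^esub> (\<alpha> x)"
    unfolding neg_def by (rule alpha_apply_zero) (simp add: a)
  have "minus (minus x) = (inv\<^bsub>S\<^esub> (\<alpha> (minus x))) zero"
    by (rule neg_def)
  with a show "minus (minus x) = x" by (simp add: 1)
  show "minus x \<in> X" "(minus x, p) \<notin> R"
    using a zero_in tau_p by (simp_all add: neg_def apply_in U_rel_p)
qed

text \<open>Apply \<open>\<alpha> x\<close>, which carries \<open>minus x\<close> to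
  \<open>zero\<close> and \<open>zero\<close> to \<open>x\<close>.\<close>

lemma minus_rel_zero:
  assumes "x \<in> X" "(x, p) \<notin> R"
  shows "(minus x, zero) \<in> R \<longleftrightarrow> (x, zero) \<in> R"
proof -
  note a = alpha_props[OF assms]
  have "(minus x, zero) \<in> R \<longleftrightarrow> (\<alpha> x (minus x), \<alpha> x zero) \<in> R"
    using a(1) minus_props(3)[OF assms] zero_in by (simp add: apply_rel)
  also have "\<dots> \<longleftrightarrow> (zero, x) \<in> R"
    using a by (simp add: neg_def apply_inv)
  finally show ?thesis using rel_sym by blast
qed

lemma gamma_in: "\<alpha> z \<in> U \<Longrightarrow> \<gamma> z \<in> U0"
  unfolding gamma_def by (rule S.conj_set_memI)

lemma gamma_apply_p: "\<gamma> z p = \<tau> (\<alpha> z zero)"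
  by (simp add: gamma_def mult_apply itau_p)

lemma itau_rel:
  assumes "x \<in> X"
  shows "itau x \<in> X" "(itau x, p) \<in> R \<longleftrightarrow> (x, zero) \<in> R" "(itau x, zero) \<in> R \<longleftrightarrow> (x, p) \<in> R"
proof -
  show i: "itau x \<in> X" using assms tau by (simp add: apply_in)
  show "(itau x, p) \<in> R \<longleftrightarrow> (x, zero) \<in> R" "(itau x, zero) \<in> R \<longleftrightarrow> (x, p) \<in> R"
    using apply_rel[OF tau i p] apply_rel[OF tau i zero_in]
    by (simp_all add: apply_inv[OF tau] tau_tau_p)
qed

text \<open>The counterpart of \<open>alpha_props\<close> for \<open>U0\<close>, with the roles of
  \<open>p\<close> and \<open>zero\<close> interchanged.\<close>

lemma gamma_itau:
  assumes "x \<in> X" "(x, zero) \<notin> R"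
  shows "\<gamma> (itau x) \<in> U0" "\<gamma> (itau x) p = x" "\<alpha> (itau x) \<in> U"
proof -
  have "itau x \<in> X" "(itau x, p) \<notin> R" using assms itau_rel by auto
  note a = alpha_props[OF this]
  then show "\<gamma> (itau x) \<in> U0" "\<gamma> (itau x) p = x" "\<alpha> (itau x) \<in> U"
    by (simp_all add: gamma_in gamma_apply_p apply_inv[OF tau])
qed

text \<open>If \<open>d\<close> is the conjugate of \<open>u\<close> by \<open>\<tau>\<close>, then
  \<open>itau (d p)\<close> is \<open>u zero\<close>, which determines \<open>u\<close>.\<close>

lemma gamma_unique:
  assumes d: "d \<in> U0"
  shows "d = \<gamma> (itau (d p))"
proof -
  obtain u where u: "u \<in> U" "d = itau \<otimes>\<^bsub>S\<^esub> u \<otimes>\<^bsub>S\<^esub> \<tau>"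
    using d by (auto simp: conj_set_def)
  have "itau (d p) = u zero"
    by (simp add: u(2) mult_apply itau_p inv_apply[OF tau])
  then show ?thesis by (simp add: gamma_def alpha_apply_zero u)
qed

lemma not_rel_p_and_zero: "(x, p) \<in> R \<Longrightarrow> (x, zero) \<notin> R"
  using tau_p rel_sym rel_trans by blast

text \<open>Indexing by elements of \<open>U\<close> instead of points turns products in
  \<open>U\<close> into statements about root groups. The analogue for \<open>U0\<close> holds at
  first only near \<open>p\<close>; extending it to units is the content of
  \<open>root_gamma\<close>.\<close>

lemma root_alpha:
  assumes "u \<in> U"
  shows "root (u zero) = conj U0 u"
  using assms zero_in tau_p by (simp add: root_group_def U_rel_p alpha_apply_zero)

lemma root_zero: "root zero = U0"
  using root_alpha[of "\<one>\<^bsub>S\<^esub>"] subgroup.one_closed[OF U_subgroup]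
  by (simp add: one_apply S.conj_set_one U0_carrier)

lemma root_gamma_near:
  assumes "(x, p) \<in> R"
  shows "root x = conj U (\<gamma> (itau x))"
  using assms by (simp add: root_group_def)

lemma root_p: "root p = U"
proof -
  have "\<alpha> zero = \<one>\<^bsub>S\<^esub>"
    using alpha_apply_zero[OF subgroup.one_closed[OF U_subgroup]] by (simp add: one_apply)
  then have "\<gamma> (itau p) = \<one>\<^bsub>S\<^esub>" using tau by (simp add: gamma_def itau_p)
  then show ?thesis using p by (simp add: root_gamma_near rel_refl S.conj_set_one U_carrier)
qed

section \<open>Root groups as conjugates of \<open>U\<close>, and the axioms other than LM3\<close>

definition transporter :: "'a \<Rightarrow> 'a \<Rightarrow> 'a" where
  "transporter x = (if (x, p) \<in> R then \<gamma> (itau x) else \<tau> \<otimes>\<^bsub>S\<^esub> \<alpha> x)"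

text \<open>Both cases of \<open>root_group\<close> take one form, a conjugate of \<open>U\<close>
  by an element moving \<open>p\<close> to \<open>x\<close>. In the second case
  \<open>\<tau>\<close> first turns \<open>U\<close> into \<open>U0\<close> and \<open>p\<close>
  into \<open>zero\<close>.\<close>

lemma transporter:
  assumes x: "x \<in> X"
  shows "transporter x \<in> carrier S" "transporter x p = x" "root x = conj U (transporter x)"
proof -
  have "transporter x \<in> carrier S \<and> transporter x p = x \<and> root x = conj U (transporter x)"
  proof (cases "(x, p) \<in> R")
    case True
    note g = gamma_itau[OF x not_rel_p_and_zero[OF True]]
    show ?thesis using True g by (simp add: transporter_def root_gamma_near)
  next
    case False
    note a = alpha_props[OF x False]
    then show ?thesis
      using False tau root_alpha[of "\<alpha> x"]
      by (simp add: transporter_def mult_apply S.conj_set_mult U_carrier)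
  qed
  then show "transporter x \<in> carrier S" "transporter x p = x" "root x = conj U (transporter x)"
    by auto
qed

text \<open>By (C1'), an element of the induced group is determined by its image of the class of
  \<open>zero\<close>.\<close>

lemma induced_U_eqI:
  assumes "a \<in> U" "b \<in> U" "(a zero, b zero) \<in> R"
  shows "induced X R a = induced X R b"
proof -
  have mem: "R `` {x} \<in> X // R - {R `` {p}}" if "x \<in> X" "(x, p) \<notin> R" for x
    using that p eq_equiv_class_iff[OF equiv, of x p] by (simp add: quotientI)
  have z: "R `` {zero} \<in> X // R - {R `` {p}}" by (rule mem[OF zero_in tau_p])
  have az: "R `` {a zero} \<in> X // R - {R `` {p}}"
    using assms zero_in tau_p by (intro mem) (simp_all add: apply_in U_rel_p)
  have "R `` {a zero} = R `` {b zero}" by (rule equiv_class_eq[OF equiv assms(3)])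
  then have "induced X R a (R `` {zero}) = R `` {a zero}" "induced X R b (R `` {zero}) = R `` {a zero}"
    using assms zero_in by (simp_all add: induced_class)
  moreover have "\<exists>!h. h \<in> induced X R ` U \<and> h (R `` {zero}) = R `` {a zero}"
    using U_induced_sharp z az by (simp add: sharply_transitive_on_def)
  ultimately show ?thesis using assms by blast
qed

text \<open>Near \<open>p\<close>, the point \<open>itau w\<close> lies in the class of
  \<open>zero\<close>, so \<open>\<alpha> (itau w)\<close> induces the identity, and so does its
  conjugate \<open>\<gamma> (itau w)\<close>. Elsewhere \<open>induced_U_eqI\<close> applies to
  \<open>\<alpha> x\<close> and \<open>\<alpha> y\<close>.\<close>

lemma induced_transporter:
  assumes xy: "(x, y) \<in> R"
  shows "induced X R (transporter x) = induced X R (transporter y)"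
proof (cases "(x, p) \<in> R")
  case True
  have "induced X R (transporter w) = id" if w: "(w, p) \<in> R" for w
  proof -
    have wX: "w \<in> X" using w rel_in by simp
    note g = gamma_itau[OF wX not_rel_p_and_zero[OF w]]
    have iw: "itau w \<in> X" "(itau w, p) \<notin> R" "(itau w, zero) \<in> R"
      using itau_rel[OF wX] not_rel_p_and_zero[OF w] w by auto
    have "induced X R (\<alpha> (itau w)) = induced X R \<one>\<^bsub>S\<^esub>"
      using iw alpha_props[OF iw(1,2)] subgroup.one_closed[OF U_subgroup]
      by (intro induced_U_eqI) (simp_all add: one_apply)
    then have "induced X R (\<gamma> (itau w)) = id"
      using g tau by (simp add: gamma_def induced_mult induced_one fun_eq_iff induced_inv)
    with w show ?thesis by (simp add: transporter_def)
  qed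
  moreover have "(y, p) \<in> R" using True xy rel_sym rel_trans by blast
  ultimately show ?thesis using True by simp
next
  case False
  then have y: "(y, p) \<notin> R" using xy rel_trans by blast
  note a = alpha_props[OF _ False] alpha_props[OF _ y]
  have "induced X R (\<alpha> x) = induced X R (\<alpha> y)"
    using a xy rel_in by (intro induced_U_eqI) auto
  with False y a xy tau show ?thesis
    using rel_in by (auto simp: transporter_def induced_mult)
qed

text \<open>LM2 and LM2' are (C1) and (C1') at \<open>p\<close>, carried to \<open>x\<close> by
  \<open>transporter x\<close>; only LM3 is left as a condition.\<close>

lemma local_moufang_setI:
  assumes LM3: "\<And>x g. x \<in> X \<Longrightarrow> g \<in> generate S (\<Union>y\<in>X. root y) \<Longrightarrow> conj (root x) g = root (g x)"
  shows "local_moufang_set X R root"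
proof
  show "equiv X R" by (rule equiv)
  show "more_than_two_classes X R" by (rule classes)
  show "\<forall>x\<in>X. subgroup (root x) S"
    by (simp add: transporter S.subgroup_conj_set U_subgroup)
  show "\<forall>x\<in>X. \<forall>y\<in>X. (x, y) \<in> R \<longrightarrow> induced X R ` root x = induced X R ` root y"
    by (intro ballI impI, simp only: transporter(3))
      (intro induced_conj_set_cong U_carrier transporter(1) induced_transporter)
  show "\<forall>x\<in>X. \<forall>g\<in>generate S (\<Union>y\<in>X. root y). conj (root x) g = root (g x)"
    using LM3 by blast
  show "\<forall>x\<in>X. (\<forall>u\<in>root x. u x = x) \<and> sharply_transitive_on (root x) (X - R `` {x})"
  proof
    fix x assume x: "x \<in> X"
    let ?g = "transporter x"
    note t = transporter[OF x]
    have "(inv\<^bsub>S\<^esub> ?g) x = p" using inv_apply[OF t(1), of p] t(2) by simp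
    then have "\<forall>u\<in>root x. u x = x"
      by (simp add: t(2,3) conj_set_eq U_fix)
    moreover have "sharply_transitive_on (root x) (?g ` (X - R `` {p}))"
      unfolding t(3) conj_set_eq
      using t(1) by (intro sharply_transitive_on_conj U_sharp) (simp_all add: apply_inv inv_apply)
    ultimately show "(\<forall>u\<in>root x. u x = x) \<and> sharply_transitive_on (root x) (X - R `` {x})"
      using t p by (simp add: image_outside_class)
  qed
  show "\<forall>x\<in>X. (\<forall>u\<in>induced X R ` root x. u (R `` {x}) = R `` {x}) \<and>
          sharply_transitive_on (induced X R ` root x) (X // R - {R `` {x}})"
  proof
    fix x assume x: "x \<in> X"
    let ?g = "transporter x"
    note t = transporter[OF x]
    have "(inv\<^bsub>S\<^esub> ?g) x = p" using inv_apply[OF t(1), of p] t(2) by simp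
    then have "\<forall>u\<in>induced X R ` root x. u (R `` {x}) = R `` {x}"
      using t x p by (simp add: induced_conj_set[OF U_carrier] induced_class U_fix)
    moreover have
      "sharply_transitive_on (induced X R ` root x) (induced X R ?g ` (X // R - {R `` {p}}))"
      unfolding t(3) induced_conj_set[OF U_carrier t(1)]
      using t(1) by (intro sharply_transitive_on_conj U_induced_sharp) (simp_all add: induced_inv)
    ultimately show "(\<forall>u\<in>induced X R ` root x. u (R `` {x}) = R `` {x}) \<and>
        sharply_transitive_on (induced X R ` root x) (X // R - {R `` {x}})"
      using t p by (simp add: induced_image_other_classes)
  qed
qed

section \<open>Hua maps and \<open>\<mu>\<close>-maps\<close>

text \<open>The image of \<open>p\<close> under the inverse of \<open>\<gamma> (itau x)\<close>, for
  a unit \<open>x\<close>.\<close>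

definition reflect :: "'a \<Rightarrow> 'a" where
  "reflect x = \<tau> (minus (itau x))"

text \<open>The first two factors take \<open>zero\<close> via \<open>x\<close> to \<open>p\<close>,
  and \<open>p\<close> to \<open>reflect x\<close>. The last one fixes \<open>p\<close> and brings
  \<open>reflect x\<close> back to \<open>zero\<close>.\<close>

definition mu :: "'a \<Rightarrow> 'a \<Rightarrow> 'a" where
  "mu x = \<alpha> x \<otimes>\<^bsub>S\<^esub> inv\<^bsub>S\<^esub> (\<gamma> (itau x)) \<otimes>\<^bsub>S\<^esub> inv\<^bsub>S\<^esub> (\<alpha> (reflect x))"

lemma is_unitD: "is_unit x \<Longrightarrow> x \<in> X \<and> (x, zero) \<notin> R \<and> (x, p) \<notin> R"
  by (simp add: is_unit_point_def)

lemma is_unit_reflect: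
  assumes "is_unit x"
  shows "is_unit (reflect x)"
proof -
  have i: "itau x \<in> X" "(itau x, p) \<notin> R" "(itau x, zero) \<notin> R"
    using is_unitD[OF assms] itau_rel by auto
  let ?y = "minus (itau x)"
  have y: "?y \<in> X" "(?y, p) \<notin> R" "(?y, zero) \<notin> R"
    using minus_props[OF i(1,2)] minus_rel_zero[OF i(1,2)] i by auto
  then show ?thesis
    using apply_rel[OF tau y(1) p] apply_rel[OF tau y(1) zero_in]
    by (simp add: is_unit_point_def reflect_def apply_in[OF tau] tau_tau_p)
qed

lemma unit_props:
  assumes "is_unit x"
  shows "\<alpha> x \<in> U" "\<alpha> x zero = x" "\<gamma> (itau x) \<in> U0" "\<gamma> (itau x) p = x"
  using is_unitD[OF assms] alpha_props[of x] gamma_itau[of x] by auto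

lemma mu_closed: "is_unit x \<Longrightarrow> mu x \<in> carrier S"
  using unit_props[of x] unit_props[OF is_unit_reflect] by (simp add: mu_def)

lemma gamma_minus:
  assumes "z \<in> X" "(z, p) \<notin> R"
  shows "\<gamma> (minus z) = inv\<^bsub>S\<^esub> (\<gamma> z)"
  using alpha_props(1)[OF assms] tau
  by (simp add: gamma_def minus_props(1)[OF assms] S.inv_mult_group S.m_assoc)

text \<open>On units \<open>reflect\<close> is an involution that turns the middle factor of
  \<open>mu\<close> into its inverse, so inverting the product just exchanges the outer
  factors.\<close>

lemma mu_reflect:
  assumes x: "is_unit x"
  shows "mu (reflect x) = inv\<^bsub>S\<^esub> (mu x)"
proof -
  have i: "itau x \<in> X" "(itau x, p) \<notin> R"
    using is_unitD[OF x] itau_rel by auto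
  have ir: "itau (reflect x) = minus (itau x)"
    by (simp add: reflect_def inv_apply[OF tau])
  then have "reflect (reflect x) = x"
    unfolding reflect_def[of "reflect x"] by (simp add: minus_props(2)[OF i] apply_inv[OF tau])
  moreover have "\<gamma> (itau (reflect x)) = inv\<^bsub>S\<^esub> (\<gamma> (itau x))"
    unfolding ir by (rule gamma_minus[OF i])
  ultimately show ?thesis
    using unit_props[OF x] unit_props[OF is_unit_reflect[OF x]]
    by (simp add: mu_def[of "reflect x"] mu_def[of x] S.inv_mult_group S.m_assoc)
qed

lemma mu_zero:
  assumes x: "is_unit x"
  shows "mu x zero = p"
proof -
  have "(inv\<^bsub>S\<^esub> (\<gamma> (itau x))) x = p"
    using unit_props[OF x] inv_apply[of "\<gamma> (itau x)" p] by simp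
  then show ?thesis
    using unit_props[OF x] unit_props(1)[OF is_unit_reflect[OF x]]
    by (simp add: mu_def mult_apply U_fix)
qed

text \<open>This is \<open>mu_zero\<close> at \<open>reflect x\<close>, read for the
  inverse.\<close>

lemma mu_p:
  assumes x: "is_unit x"
  shows "mu x p = zero"
  using apply_inv[OF mu_closed[OF x], of zero] mu_zero[OF is_unit_reflect[OF x]]
  by (simp add: mu_reflect[OF x])

text \<open>Each \<open>minus\<close> under an \<open>\<alpha>\<close> becomes an inverse; the three
  middle factors of the Hua map then form the inverse of \<open>\<gamma> (itau x)\<close>.\<close>

lemma hua_eq_mu:
  assumes x: "is_unit x"
  shows "hua X R U \<tau> p x = \<tau> \<otimes>\<^bsub>S\<^esub> mu x"
proof -
  have i: "itau x \<in> X" "(itau x, p) \<notin> R"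
    using is_unitD[OF x] itau_rel by auto
  have r: "reflect x \<in> X" "(reflect x, p) \<notin> R"
    using is_unitD[OF is_unit_reflect[OF x]] by auto
  show ?thesis
    using alpha_props(1)[OF i] alpha_props(1)[OF r] unit_props(1)[OF x] tau
    by (simp add: hua_def Let_def mu_def gamma_def minus_props(1)[OF i]
        minus_props(1)[OF r] S.inv_mult_group S.m_assoc flip: reflect_def)
qed

lemma conj_hua:
  assumes x: "is_unit x"
  shows "conj U (hua X R U \<tau> p x) = conj U0 (mu x)"
  using tau mu_closed[OF x] by (simp add: hua_eq_mu[OF x] S.conj_set_mult U_carrier)

text \<open>A third class is needed here: otherwise the classes of \<open>p\<close> and
  \<open>zero\<close> would exhaust the quotient.\<close>

lemma exists_unit: "\<exists>x. is_unit x"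
proof (rule ccontr)
  assume no: "\<nexists>x. is_unit x"
  have "X // R \<subseteq> {R `` {p}, R `` {zero}}"
  proof
    fix C assume "C \<in> X // R"
    then obtain x where x: "x \<in> X" "C = R `` {x}" by (auto elim: quotientE)
    with no have "(x, zero) \<in> R \<or> (x, p) \<in> R" by (auto simp: is_unit_point_def)
    then show "C \<in> {R `` {p}, R `` {zero}}" using x equiv_class_eq[OF equiv] by auto
  qed
  moreover from this have "finite (X // R)" by (rule finite_subset) simp
  moreover have "card {R `` {p}, R `` {zero}} \<le> 2" by (simp add: card_insert_if)
  ultimately have "card (X // R) \<le> 2"
    by (meson card_mono finite.emptyI finite.insertI le_trans)
  with \<open>finite (X // R)\<close> show False using classes by (simp add: more_than_two_classes_def)
qed

lemma hua_normalizes: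
  assumes lm: "local_moufang_set X R root" and x: "is_unit x"
  shows "conj U (hua X R U \<tau> p x) = U"
proof -
  interpret lm: local_moufang_set X R root by (rule lm)
  let ?G = "generate S (\<Union>y\<in>X. root y)"
  have "(\<Union>y\<in>X. root y) \<subseteq> carrier S"
    using lm.root_subgroup subgroup.subset by blast
  then have G: "subgroup ?G S" by (rule S.generate_is_subgroup)
  have sub: "U \<subseteq> ?G" "U0 \<subseteq> ?G"
    using root_p root_zero p zero_in by (auto intro: generate.incl)
  \<comment> \<open>The factors of \<open>mu x\<close> lie in the root groups at \<open>p\<close>
    and \<open>zero\<close>, so LM3 may be applied to it.\<close>
  have "mu x \<in> ?G"
    unfolding mu_def
    using unit_props[OF x] unit_props(1)[OF is_unit_reflect[OF x]] sub
    by (intro subgroup.m_closed[OF G] subgroup.m_inv_closed[OF G]) auto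
  then have "conj (root zero) (mu x) = root (mu x zero)"
    using lm.LM3 zero_in by blast
  then show ?thesis by (simp add: conj_hua[OF x] mu_zero[OF x] root_zero root_p)
qed

end

section \<open>Sufficiency of the condition on Hua maps\<close>

locale hua_construction = moufang_construction +
  assumes hua: "is_unit x \<Longrightarrow> conj U (hua X R U \<tau> p x) = U"
begin

lemma conj_U0_mu: "is_unit x \<Longrightarrow> conj U0 (mu x) = U"
  using hua conj_hua by simp

lemma conj_U_mu:
  assumes x: "is_unit x"
  shows "conj U (mu x) = U0"
proof -
  have "conj U0 (inv\<^bsub>S\<^esub> (mu x)) = U"
    using conj_U0_mu[OF is_unit_reflect[OF x]] by (simp add: mu_reflect[OF x])
  from S.conj_set_inv[OF U0_carrier _ this] show ?thesis using mu_closed[OF x] by simp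
qed

text \<open>At a unit, \<open>mu\<close> ties \<open>d\<close> to \<open>\<alpha> (d p)\<close>: the
  relation \<open>conj U0 (mu x) = U\<close> is unwound factor by factor.\<close>

lemma root_gamma:
  assumes d: "d \<in> U0"
  shows "root (d p) = conj U d"
proof (cases "(d p, p) \<in> R")
  case True
  then show ?thesis using root_gamma_near[OF True] gamma_unique[OF d] by simp
next
  case False
  let ?x = "d p"
  have "(p, zero) \<notin> R" using tau_p rel_sym by blast
  with False d p have x: "is_unit ?x"
    by (simp add: is_unit_point_def apply_in U0_rel_zero)
  note u = unit_props[OF x] and v = unit_props(1)[OF is_unit_reflect[OF x]]
  have d': "\<gamma> (itau ?x) = d" using gamma_unique[OF d] by simp
  have "conj (conj (conj U0 (\<alpha> ?x)) (inv\<^bsub>S\<^esub> d)) (inv\<^bsub>S\<^esub> (\<alpha> (reflect ?x))) = U"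
    using conj_U0_mu[OF x] u v d
    by (simp add: mu_def d' S.conj_set_mult U0_carrier S.conj_set_closed)
  moreover have "conj U0 (\<alpha> ?x) = root ?x" using root_alpha[OF u(1)] u(2) by simp
  ultimately have e: "conj (conj (root ?x) (inv\<^bsub>S\<^esub> d)) (inv\<^bsub>S\<^esub> (\<alpha> (reflect ?x))) = U" by simp
  have rc: "root ?x \<subseteq> carrier S"
    using u by (simp add: \<open>conj U0 (\<alpha> ?x) = root ?x\<close>[symmetric] S.conj_set_closed U0_carrier)
  have "conj (root ?x) (inv\<^bsub>S\<^esub> d) = conj U (\<alpha> (reflect ?x))"
    using S.conj_set_inv[OF _ _ e] rc v d by (simp add: S.conj_set_closed)
  \<comment> \<open>The outer factor of \<open>mu\<close> belongs to \<open>U\<close>, hence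
    normalizes it and drops out.\<close>
  also have "\<dots> = U" by (rule S.conj_set_self[OF U_subgroup v])
  finally show ?thesis using S.conj_set_inv[OF rc, of "inv\<^bsub>S\<^esub> d" U] d by simp
qed

text \<open>The elements satisfying LM3 at every point. As they form a subgroup, LM3 needs to be
  checked only on the root groups.\<close>

definition root_preserving :: "('a \<Rightarrow> 'a) set" where
  "root_preserving = {g \<in> carrier S. \<forall>x\<in>X. conj (root x) g = root (g x)}"

lemma root_carrier: "x \<in> X \<Longrightarrow> root x \<subseteq> carrier S"
  using S.conj_set_closed[OF U_carrier] transporter by simp

text \<open>Kept pointwise, because some factors are at first known to behave well only at certain
  points.\<close>

lemma conj_root_mult:
  assumes "g \<in> carrier S" "h \<in> carrier S" "x \<in> X"
    and "conj (root x) g = root (g x)" "conj (root (g x)) h = root (h (g x))"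
  shows "conj (root x) (g \<otimes>\<^bsub>S\<^esub> h) = root ((g \<otimes>\<^bsub>S\<^esub> h) x)"
  using assms S.conj_set_mult[OF root_carrier, of x g h] by (simp add: mult_apply)

lemma subgroup_root_preserving: "subgroup root_preserving S"
proof (rule S.subgroupI)
  show "root_preserving \<subseteq> carrier S" by (auto simp: root_preserving_def)
  have "\<one>\<^bsub>S\<^esub> \<in> root_preserving"
    by (simp add: root_preserving_def one_apply S.conj_set_one root_carrier)
  then show "root_preserving \<noteq> {}" by auto
next
  fix g assume g: "g \<in> root_preserving"
  then have gc: "g \<in> carrier S" by (simp add: root_preserving_def)
  have "conj (root x) (inv\<^bsub>S\<^esub> g) = root ((inv\<^bsub>S\<^esub> g) x)" if x: "x \<in> X" for x
  proof -
    let ?y = "(inv\<^bsub>S\<^esub> g) x"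
    have y: "?y \<in> X" using gc x by (simp add: apply_in)
    with g have "conj (root ?y) g = root x"
      by (simp add: root_preserving_def apply_inv[OF gc])
    then show ?thesis by (rule S.conj_set_inv[OF root_carrier[OF y] gc])
  qed
  with gc show "inv\<^bsub>S\<^esub> g \<in> root_preserving" by (simp add: root_preserving_def)
next
  fix g h assume "g \<in> root_preserving" "h \<in> root_preserving"
  then show "g \<otimes>\<^bsub>S\<^esub> h \<in> root_preserving"
    unfolding root_preserving_def
    by (intro CollectI conjI ballI conj_root_mult) (simp_all add: apply_in)
qed

lemma conj_root_U:
  assumes u: "u \<in> U" and x: "x \<in> X" "(x, p) \<notin> R"
  shows "conj (root x) u = root (u x)"
proof -
  note a = alpha_props[OF x]
  have "conj (root x) u = conj U0 (\<alpha> x \<otimes>\<^bsub>S\<^esub> u)"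
    using root_alpha[OF a(1)] a u by (simp add: S.conj_set_mult U0_carrier)
  also have "\<dots> = root (u x)"
    using root_alpha[of "\<alpha> x \<otimes>\<^bsub>S\<^esub> u"] a u by (simp add: mult_apply)
  finally show ?thesis .
qed

text \<open>Rests on \<open>root_gamma\<close>, which describes every root group outside the class
  of \<open>zero\<close> as a \<open>U0\<close>-conjugate of \<open>U\<close>.\<close>

lemma conj_root_U0:
  assumes u: "u \<in> U0" and x: "x \<in> X" "(x, zero) \<notin> R"
  shows "conj (root x) u = root (u x)"
proof -
  note g = gamma_itau[OF x]
  let ?d = "\<gamma> (itau x)"
  have "conj (root x) u = conj U (?d \<otimes>\<^bsub>S\<^esub> u)"
    using root_gamma[OF g(1)] g u by (simp add: S.conj_set_mult U_carrier)
  also have "\<dots> = root (u x)"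
    using root_gamma[of "?d \<otimes>\<^bsub>S\<^esub> u"] g u subgroup.m_closed[OF U0_subgroup]
    by (simp add: mult_apply)
  finally show ?thesis .
qed

lemma conj_mult_swap:
  assumes "V \<subseteq> carrier S" "a \<in> carrier S" "m \<in> carrier S"
  shows "conj (conj V a) m = conj (conj V m) (inv\<^bsub>S\<^esub> m \<otimes>\<^bsub>S\<^esub> a \<otimes>\<^bsub>S\<^esub> m)"
proof -
  have "m \<otimes>\<^bsub>S\<^esub> (inv\<^bsub>S\<^esub> m \<otimes>\<^bsub>S\<^esub> a \<otimes>\<^bsub>S\<^esub> m) = a \<otimes>\<^bsub>S\<^esub> m"
    using assms by (simp add: S.m_assoc[symmetric])
  with assms show ?thesis by (simp add: S.conj_set_mult)
qed

text \<open>As \<open>mu e\<close> interchanges \<open>U\<close> with \<open>U0\<close> and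
  \<open>p\<close> with \<open>zero\<close>, it interchanges the descriptions
  \<open>root_alpha\<close> and \<open>root_gamma\<close>.\<close>

lemma mu_root_preserving:
  assumes e: "is_unit e"
  shows "mu e \<in> root_preserving"
proof -
  let ?m = "mu e"
  note m = mu_closed[OF e]
  have ip: "(inv\<^bsub>S\<^esub> ?m) p = zero" and iz: "(inv\<^bsub>S\<^esub> ?m) zero = p"
    using inv_apply[OF m, of zero] inv_apply[OF m, of p] by (simp_all add: mu_zero mu_p e)
  have "conj (root x) ?m = root (?m x)" if x: "x \<in> X" for x
  proof (cases "(x, p) \<in> R")
    case True
    note g = gamma_itau[OF x not_rel_p_and_zero[OF True]]
    let ?d = "\<gamma> (itau x)" and ?b = "inv\<^bsub>S\<^esub> ?m \<otimes>\<^bsub>S\<^esub> \<gamma> (itau x) \<otimes>\<^bsub>S\<^esub> ?m"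
    have b: "?b \<in> U" using S.conj_set_memI[OF g(1), of ?m] by (simp add: conj_U0_mu[OF e])
    have "conj (root x) ?m = conj (conj U ?d) ?m"
      using root_gamma[OF g(1)] g(2) by simp
    also have "\<dots> = conj U0 ?b"
      using conj_mult_swap[OF U_carrier _ m, of ?d] g(1) by (simp add: conj_U_mu[OF e])
    also have "\<dots> = root (?b zero)" by (rule root_alpha[OF b, symmetric])
    \<comment> \<open>The inverse of \<open>?m\<close> takes \<open>zero\<close> to
      \<open>p\<close>, then \<open>?d\<close> takes \<open>p\<close> to \<open>x\<close>.\<close>
    also have "?b zero = ?m x" by (simp add: mult_apply iz g(2))
    finally show ?thesis .
  next
    case False
    note a = alpha_props[OF x False]
    let ?d = "inv\<^bsub>S\<^esub> ?m \<otimes>\<^bsub>S\<^esub> \<alpha> x \<otimes>\<^bsub>S\<^esub> ?m"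
    have d: "?d \<in> U0" using S.conj_set_memI[OF a(1), of ?m] by (simp add: conj_U_mu[OF e])
    have "conj (root x) ?m = conj (conj U0 (\<alpha> x)) ?m"
      using root_alpha[OF a(1)] a(2) by simp
    also have "\<dots> = conj U ?d"
      using conj_mult_swap[OF U0_carrier _ m, of "\<alpha> x"] a(1) by (simp add: conj_U0_mu[OF e])
    also have "\<dots> = root (?d p)" by (rule root_gamma[OF d, symmetric])
    also have "?d p = ?m x" by (simp add: mult_apply ip a(2))
    finally show ?thesis .
  qed
  with m show ?thesis by (simp add: root_preserving_def)
qed

lemma alpha_unit_root_preserving:
  assumes e: "is_unit e"
  shows "\<alpha> e \<in> root_preserving"
proof -
  let ?r = "\<alpha> (reflect e)" and ?d = "\<gamma> (itau e)"
  note u = unit_props[OF e] and v = unit_props(1,2)[OF is_unit_reflect[OF e]]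
  note m = mu_closed[OF e] and r = is_unitD[OF is_unit_reflect[OF e]]
  \<comment> \<open>The definition of \<open>mu e\<close> is solved for
    \<open>\<alpha> e\<close>.\<close>
  have "mu e \<otimes>\<^bsub>S\<^esub> ?r = \<alpha> e \<otimes>\<^bsub>S\<^esub> inv\<^bsub>S\<^esub> ?d"
    unfolding mu_def using u(1,3) v(1) by (simp add: S.m_assoc)
  then have eq: "\<alpha> e = mu e \<otimes>\<^bsub>S\<^esub> ?r \<otimes>\<^bsub>S\<^esub> ?d"
    using u(1,3) by (simp add: S.m_assoc)
  have "conj (root x) (\<alpha> e) = root (\<alpha> e x)" if x: "x \<in> X" for x
  proof (cases "(x, p) \<in> R")
    case False
    then show ?thesis by (rule conj_root_U[OF u(1) x])
  next
    case True
    let ?y = "mu e x"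
    have y: "?y \<in> X" using x m by (simp add: apply_in)
    have yz: "(?y, zero) \<in> R" using apply_rel[OF m x p] True by (simp add: mu_p[OF e])
    then have yp: "(?y, p) \<notin> R" using not_rel_p_and_zero by blast
    \<comment> \<open>Since \<open>?y\<close> is near \<open>zero\<close>, \<open>?r\<close> moves
      it near the unit \<open>reflect e\<close>, hence out of the class of \<open>zero\<close>, as
      \<open>conj_root_U0\<close> requires for \<open>?d\<close>.\<close>
    have "(?r ?y, reflect e) \<in> R"
      using apply_rel[of ?r ?y zero] yz y zero_in v by simp
    then have z: "?r ?y \<in> X" "(?r ?y, zero) \<notin> R"
      using r rel_in rel_sym rel_trans by blast+
    have "conj (root x) (mu e) = root ?y"
      using mu_root_preserving[OF e] x by (simp add: root_preserving_def)
    then have "conj (root x) (mu e \<otimes>\<^bsub>S\<^esub> ?r) = root ((mu e \<otimes>\<^bsub>S\<^esub> ?r) x)"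
      using m v(1) x conj_root_U[OF v(1) y yp] by (intro conj_root_mult) auto
    moreover have "conj (root (?r ?y)) ?d = root (?d (?r ?y))"
      by (rule conj_root_U0[OF u(3) z])
    ultimately show ?thesis
      unfolding eq using m u(3) v(1) x
      by (intro conj_root_mult[of "mu e \<otimes>\<^bsub>S\<^esub> ?r"]) (simp_all only: mult_apply S.m_closed U_closed U0_closed)
  qed
  with u(1) show ?thesis by (simp add: root_preserving_def)
qed

text \<open>An element of \<open>U\<close> moving \<open>0\<close> inside its class is a product of two that move it to units.\<close>

lemma U_root_preserving: "U \<subseteq> root_preserving"
proof
  fix u assume u: "u \<in> U"
  have unit: "w \<in> root_preserving" if "w \<in> U" "(w zero, zero) \<notin> R" for w
  proof -
    have "is_unit (w zero)"
      using that zero_in tau_p by (simp add: is_unit_point_def apply_in U_rel_p)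
    from alpha_unit_root_preserving[OF this] show ?thesis using that by (simp add: alpha_apply_zero)
  qed
  show "u \<in> root_preserving"
  proof (cases "(u zero, zero) \<in> R")
    case False
    with u unit show ?thesis by simp
  next
    case True
    obtain e where e: "is_unit e" using exists_unit by blast
    note a = unit_props(1,2)[OF e]
    have "((u \<otimes>\<^bsub>S\<^esub> \<alpha> e) zero, e) \<in> R"
      using True apply_rel[of "\<alpha> e" "u zero" zero] a u zero_in by (simp add: mult_apply apply_in)
    then have "((u \<otimes>\<^bsub>S\<^esub> \<alpha> e) zero, zero) \<notin> R"
      using is_unitD[OF e] rel_sym rel_trans by blast
    then have "u \<otimes>\<^bsub>S\<^esub> \<alpha> e \<in> root_preserving" using u a by (intro unit) simp_all
    moreover have "inv\<^bsub>S\<^esub> (\<alpha> e) \<in> root_preserving"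
      by (rule subgroup.m_inv_closed[OF subgroup_root_preserving alpha_unit_root_preserving[OF e]])
    ultimately have "u \<otimes>\<^bsub>S\<^esub> \<alpha> e \<otimes>\<^bsub>S\<^esub> inv\<^bsub>S\<^esub> (\<alpha> e) \<in> root_preserving"
      by (rule subgroup.m_closed[OF subgroup_root_preserving])
    then show ?thesis using u a by (simp add: S.m_assoc)
  qed
qed

lemma conj_root_preserving:
  assumes "V \<subseteq> root_preserving" "g \<in> root_preserving"
  shows "conj V g \<subseteq> root_preserving"
  using assms subgroup_root_preserving
  by (auto simp: conj_set_def intro!: subgroup.m_closed subgroup.m_inv_closed)

text \<open>\<open>U0\<close> is the conjugate of \<open>U\<close> by a single \<open>mu e\<close>,
  and both lie in the subgroup.\<close>

lemma U0_root_preserving: "U0 \<subseteq> root_preserving"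
proof -
  obtain e where e: "is_unit e" using exists_unit by blast
  show ?thesis
    using conj_root_preserving[OF U_root_preserving mu_root_preserving[OF e]]
    by (simp add: conj_U_mu[OF e])
qed

text \<open>By construction a root group is \<open>U\<close> conjugated by an element of
  \<open>U0\<close>, or \<open>U0\<close> conjugated by an element of \<open>U\<close>.\<close>

lemma root_subset_root_preserving:
  assumes x: "x \<in> X"
  shows "root x \<subseteq> root_preserving"
proof (cases "(x, p) \<in> R")
  case True
  with U_root_preserving U0_root_preserving show ?thesis
    using gamma_itau(1)[OF x not_rel_p_and_zero[OF True]]
    by (simp add: root_gamma_near) (intro conj_root_preserving; blast)
next
  case False
  note a = alpha_props[OF x False]
  have "root x = conj U0 (\<alpha> x)" using root_alpha[OF a(1)] a(2) by simp
  with a(1) U_root_preserving U0_root_preserving show ?thesis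
    using conj_root_preserving by (metis subsetD)
qed

lemma is_local_moufang_set: "local_moufang_set X R root"
proof (rule local_moufang_setI)
  fix x g assume x: "x \<in> X" and g: "g \<in> generate S (\<Union>y\<in>X. root y)"
  have "generate S (\<Union>y\<in>X. root y) \<subseteq> root_preserving"
    using root_subset_root_preserving
    by (intro S.generate_subgroup_incl subgroup_root_preserving) blast
  with x g show "conj (root x) g = root (g x)" by (auto simp: root_preserving_def)
qed

end

theorem theorem4p6:
  fixes X :: "'a set" and R :: "('a \<times> 'a) set"
    and U :: "('a \<Rightarrow> 'a) set" and \<tau> :: "'a \<Rightarrow> 'a" and p :: 'a
  assumes "equiv X R"
    and "more_than_two_classes X R"
    and "subgroup U (sym_rel X R)"
    and "\<tau> \<in> carrier (sym_rel X R)"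
    and C1: "p \<in> X" "\<forall>u\<in>U. u p = p" "sharply_transitive_on U (X - R `` {p})"
    and C1': "sharply_transitive_on (induced X R ` U) (X // R - {R `` {p}})"
    and C2: "(\<tau> p, p) \<notin> R" "\<tau> (\<tau> p) = p"
  shows "local_moufang_set X R (root_group X R U \<tau> p) \<longleftrightarrow>
    (\<forall>x. is_unit_point X R \<tau> p x \<longrightarrow> conj_set (sym_rel X R) U (hua X R U \<tau> p x) = U)"
proof -
  interpret moufang_construction X R U \<tau> p
    by (intro moufang_construction.intro equiv_on.intro moufang_construction_axioms.intro)
      (use assms in blast)+
  show ?thesis
  proof
    assume "local_moufang_set X R root"
    then show "\<forall>x. is_unit x \<longrightarrow> conj U (hua X R U \<tau> p x) = U"
      using hua_normalizes by blast
  next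
    assume "\<forall>x. is_unit x \<longrightarrow> conj U (hua X R U \<tau> p x) = U"
    then interpret hua_construction X R U \<tau> p
      by unfold_locales auto
    show "local_moufang_set X R root" by (rule is_local_moufang_set)
  qed
qed

end
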